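(* Let $n \in \mathbb{N}$ with $n \ge 3$, and let $p$ be a real number with $\frac{1}{n} \le p < 1 - \frac{1}{n}$. Let $X$ be a binomially distributed random variable with parameters $n$ and $p$. Let $k = \lfloor np \rfloor$. Then all of the following hold: (a) $\Pr[X > E[X]+1] \ge 0.5 - 2 \sqrt{\frac{n}{2\pi k (n-k)}}$; (b) $\Pr[X > E[X]+1] \ge 0.25 - \sqrt{\frac{n}{2\pi (k+1)(n-k-1)}} \left(1 - \frac{1}{k+1}\right)^{k+1} \left(1 + \frac{1}{n-k-1}\right)^{n-k-1}$; (c) $\Pr[X > E[X]+1] \ge 0.0370$.
   Context: $\mathbb{N} = \{1, 2, \dots\}$. A random variable $X$ is binomially distributed with parameters $n$ and $p$ if $\Pr[X=i] = \binom{n}{i} p^i (1-p)^{n-i}$ for all $i \in \{0,1,\dots,n\}$; then $E[X] = np$. *)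

theory Defs
  imports "HOL-Probability.Probability"
begin

text \<open>
  A real-valued random variable \<open>X\<close> on \<open>M\<close> is binomially distributed if it has the binomial point
  probabilities on \<open>{0..n}\<close>. For \<open>0 \<le> p \<le> 1\<close> on a probability space these add up to 1, so they
  determine the distribution of \<open>X\<close>.
\<close>

definition binomially_distributed ::
    "'a measure \<Rightarrow> ('a \<Rightarrow> real) \<Rightarrow> nat \<Rightarrow> real \<Rightarrow> bool" where
  "binomially_distributed M X n p \<longleftrightarrow>
     X \<in> borel_measurable M \<and>
     (\<forall>i\<in>{0..n}. measure M {\<omega> \<in> space M. X \<omega> = real i} =
        real (n choose i) * p ^ i * (1 - p) ^ (n - i))"

lemma binomially_distributed_binomial_pmf:
  assumes "0 \<le> p" "p \<le> 1"
  shows "binomially_distributed (measure_pmf (binomial_pmf n p)) real n p"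
  using assms by (simp add: binomially_distributed_def measure_pmf_single)

end

theory Submission
  imports Defs "HOL-Real_Asymp.Real_Asymp"
begin

text \<open>
  Write \<open>B(n, p)\<close> for the binomial distribution. As \<open>k \<le> n p < k + 1\<close>, an integer exceeds \<open>n p + 1\<close>
  exactly if it is at least \<open>k + 2\<close>. The probability that \<open>B(n, p)\<close> is at least \<open>k + 2\<close> increases
  with \<open>p\<close>, so the worst case is \<open>p = k / n\<close>, where the mean is the integer \<open>k\<close>. The hypotheses on \<open>p\<close>
  become \<open>1 \<le> k \<le> n - 2\<close>. From here on, \<open>b j\<close> and \<open>t c\<close> denote the probabilities that \<open>B(n, k / n)\<close>
  equals \<open>j\<close> and is at least \<open>c\<close>. Each of the three bounds comes from a lower bound on one of the tails
  \<open>t k\<close>, \<open>t (k + 1)\<close> and \<open>t (k + 2)\<close>, less the point probabilities between that tail and \<open>t (k + 2)\<close>.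
  
  The bounds (b) and (c) rest on the fact that, for a fixed mean \<open>\<mu>\<close> and a threshold \<open>c \<ge> \<mu> + 1\<close>, the
  tail of \<open>B(n, \<mu> / n)\<close> from \<open>c\<close> increases with \<open>n\<close>
  (lemma \<open>binom_tail_same_mean_Suc_le\<close>, a case of a theorem of Hoeffding). The smallest admissible value
  is \<open>n = c\<close>, where the tail is \<open>(\<mu> / c) ^ c\<close>. With \<open>c = k + 2\<close> this is \<open>(1 - 2 / (k + 2)) ^ (k + 2)\<close>,
  which increases with \<open>k\<close> and equals \<open>1 / 27 > 0.0370\<close> for \<open>k = 1\<close>: this is (c). With \<open>c = k + 1\<close> it is
  \<open>(1 - 1 / (k + 1)) ^ (k + 1) \<ge> 1 / 4\<close>, and (b) follows from \<open>t (k + 2) = t (k + 1) - b (k + 1)\<close>.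
  
  For (a), the integer mean \<open>k\<close> is a median, in the form \<open>t k \<ge> 1 / 2\<close> (lemma \<open>binom_tail_mean_ge_half\<close>),
  and \<open>t (k + 2) = t k - b k - b (k + 1)\<close>, where \<open>b (k + 1) \<le> b k\<close> because \<open>k\<close> is a mode.
  
  The point probabilities that are subtracted in (a) and (b) are bounded by Stirling's formula
  (lemma \<open>binom_prob_at_mean_le\<close>).
\<close>

section \<open>Point probabilities and tails of the binomial distribution\<close>

definition binom_prob :: "nat \<Rightarrow> real \<Rightarrow> nat \<Rightarrow> real" where
  "binom_prob n p i = real (n choose i) * p ^ i * (1 - p) ^ (n - i)"

definition binom_tail :: "nat \<Rightarrow> real \<Rightarrow> nat \<Rightarrow> real" where
  "binom_tail n p c = (\<Sum>i=c..n. binom_prob n p i)"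

lemma binom_prob_nonneg: "0 \<le> p \<Longrightarrow> p \<le> 1 \<Longrightarrow> 0 \<le> binom_prob n p i"
  by (simp add: binom_prob_def)

lemma binom_prob_eq_0: "n < i \<Longrightarrow> binom_prob n p i = 0"
  by (simp add: binom_prob_def)

lemma sum_binom_prob: "(\<Sum>i\<le>n. binom_prob n p i) = 1"
  using binomial_ring[of p "1 - p" n] by (simp add: binom_prob_def)

lemma sum_times_binom_prob: "(\<Sum>i\<le>n. real i * binom_prob n p i) = real n * p"
proof (cases n)
  case (Suc m)
  have "real (Suc i) * binom_prob (Suc m) p (Suc i) = real (Suc m) * p * binom_prob m p i" for i
  proof -
    have "real (Suc i) * real (Suc m choose Suc i) = real (Suc m) * real (m choose i)"
      using Suc_times_binomial[of i m] by (metis of_nat_mult)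
    then show ?thesis
      by (simp add: binom_prob_def mult.assoc [symmetric] del: of_nat_Suc binomial_Suc_Suc)
  qed
  then have "(\<Sum>i\<le>m. real (Suc i) * binom_prob (Suc m) p (Suc i)) = real (Suc m) * p * (\<Sum>i\<le>m. binom_prob m p i)"
    by (simp only: sum_distrib_left)
  then show ?thesis
    unfolding Suc by (subst sum.atMost_Suc_shift) (simp add: sum_binom_prob)
qed simp

lemma binom_tail_nonneg: "0 \<le> p \<Longrightarrow> p \<le> 1 \<Longrightarrow> 0 \<le> binom_tail n p c"
  by (simp add: binom_tail_def sum_nonneg binom_prob_nonneg)

lemma binom_tail_eq_prob_plus_tail:
  "binom_tail n p c = binom_prob n p c + binom_tail n p (Suc c)"
proof (cases "c \<le> n")
  case True
  then show ?thesis
    by (simp add: binom_tail_def sum.atLeast_Suc_atMost)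
qed (simp add: binom_tail_def binom_prob_eq_0)

lemma sum_lessThan_plus_binom_tail:
  "(\<Sum>i<c. binom_prob n p i) + binom_tail n p c = 1"
proof (induction c)
  case 0
  then show ?case
    using sum_binom_prob[of n p] by (simp add: binom_tail_def atLeast0AtMost)
next
  case (Suc c)
  then show ?case
    using binom_tail_eq_prob_plus_tail[of n p c] by simp
qed

text \<open>
  Pascal's rule: condition on the last of \<open>Suc n\<close> independent trials.
\<close>

lemma binom_prob_Suc_Suc:
  "binom_prob (Suc n) p (Suc i) = p * binom_prob n p i + (1 - p) * binom_prob n p (Suc i)"
proof (cases "i < n")
  case True
  then obtain m where "n = Suc (i + m)"
    using less_imp_Suc_add by blast
  then show ?thesis
    by (simp add: binom_prob_def algebra_simps)
next
  case False
  then have "n \<le> i"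
    by simp
  then show ?thesis
    by (simp add: binom_prob_def binomial_eq_0)
qed

text \<open>
  A further trial can raise the count to \<open>Suc c\<close> only if it succeeds after exactly \<open>c\<close> successes.
\<close>

lemma binom_tail_Suc_Suc:
  "binom_tail (Suc n) p (Suc c) = binom_tail n p (Suc c) + p * binom_prob n p c"
proof -
  have "binom_tail (Suc n) p (Suc c) = (\<Sum>i=c..n. binom_prob (Suc n) p (Suc i))"
    unfolding binom_tail_def by (rule sum.shift_bounds_cl_Suc_ivl)
  also have "\<dots> = p * binom_tail n p c + (1 - p) * (\<Sum>i=c..n. binom_prob n p (Suc i))"
    by (simp add: binom_prob_Suc_Suc binom_tail_def sum.distrib sum_distrib_left)
  also have "(\<Sum>i=c..n. binom_prob n p (Suc i)) = (\<Sum>i=Suc c..Suc n. binom_prob n p i)"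
    by (rule sum.shift_bounds_cl_Suc_ivl [symmetric])
  also have "\<dots> = binom_tail n p (Suc c)"
    by (cases "c \<le> n") (simp_all add: binom_tail_def binom_prob_eq_0)
  finally show ?thesis
    by (simp add: binom_tail_eq_prob_plus_tail[of n p c] algebra_simps)
qed

text \<open>
  The ratio of consecutive point probabilities, cleared of denominators so that it holds for all
  \<open>p\<close> and \<open>i\<close>. The difference on the right is taken in the reals and the case \<open>i = n\<close> makes both
  sides vanish.
\<close>

lemma binom_prob_Suc_times:
  "real (Suc i) * (1 - p) * binom_prob n p (Suc i) = (real n - real i) * p * binom_prob n p i"
proof (cases "i < n")
  case True
  then obtain m where n: "n = Suc (i + m)"
    using less_imp_Suc_add by blast
  have "Suc i * (n choose Suc i) = (n - i) * (n choose i)"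
    using binomial_absorption[of i n] binomial_absorb_comp[of n i] by simp
  then have "real (Suc i) * real (n choose Suc i) = real (n - i) * real (n choose i)"
    by (metis of_nat_mult)
  then have "real (Suc i) * (1 - p) * binom_prob n p (Suc i)
      = (real (n - i) * real (n choose i)) * p ^ Suc i * (1 - p) ^ Suc m"
    unfolding binom_prob_def using n by (simp add: mult_ac)
  also have "\<dots> = (real n - real i) * p * binom_prob n p i"
    unfolding binom_prob_def using n by (simp add: mult_ac)
  finally show ?thesis .
next
  case False
  then show ?thesis
    by (cases "i = n") (simp_all add: binom_prob_eq_0)
qed

text \<open>
  By the ratio of consecutive terms, the point probabilities do not increase from \<open>(n + 1) p - 1\<close> on.
\<close>

lemma binom_prob_Suc_le:
  assumes "0 \<le> p" "p \<le> 1" and "real (Suc n) * p \<le> real (Suc i)"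
  shows "binom_prob n p (Suc i) \<le> binom_prob n p i"
proof (cases "i < n")
  case True
  have "p < 1"
  proof (rule ccontr)
    assume "\<not> p < 1"
    with assms have "p = 1" by simp
    with assms True show False by simp
  qed
  have "(real n - real i) * p \<le> real (Suc i) * (1 - p)"
    using assms by (simp add: algebra_simps)
  then have "real (Suc i) * (1 - p) * binom_prob n p (Suc i) \<le> real (Suc i) * (1 - p) * binom_prob n p i"
    unfolding binom_prob_Suc_times by (intro mult_right_mono binom_prob_nonneg assms)
  then show ?thesis
    using \<open>p < 1\<close> by (simp add: mult_le_cancel_left_pos)
next
  case False
  then show ?thesis
    using assms by (simp add: binom_prob_eq_0 binom_prob_nonneg)
qed

lemma has_real_derivative_binom_prob:
  "((\<lambda>p. binom_prob (Suc n) p (Suc i)) has_real_derivative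
      real (Suc n) * (binom_prob n p i - binom_prob n p (Suc i))) (at p)"
proof -
  have 1: "real (Suc n choose Suc i) * real (Suc i) = real (Suc n) * real (n choose i)"
    using Suc_times_binomial[of i n] by (metis of_nat_mult mult.commute)
  have 2: "real (Suc n choose Suc i) * real (n - i) = real (Suc n) * real (n choose Suc i)"
    using binomial_absorb_comp[of "Suc n" "Suc i"] by (metis of_nat_mult mult.commute diff_Suc_Suc diff_Suc_1)
  have "((\<lambda>p. binom_prob (Suc n) p (Suc i)) has_real_derivative
      real (Suc n choose Suc i) * real (Suc i) * p ^ i * (1 - p) ^ (n - i)
      - real (Suc n choose Suc i) * real (n - i) * p ^ Suc i * (1 - p) ^ (n - Suc i)) (at p)"
    unfolding binom_prob_def
    by (rule derivative_eq_intros refl)+ (simp del: binomial_Suc_Suc add: algebra_simps)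
  then show ?thesis
    unfolding 1 2 binom_prob_def by (simp add: algebra_simps)
qed

text \<open>
  The derivatives of the point probabilities telescope, so that only the boundary term at \<open>c\<close> remains.
  Tails for different success probabilities are compared below through this formula.
\<close>

lemma has_real_derivative_binom_tail:
  "((\<lambda>p. binom_tail (Suc n) p (Suc c)) has_real_derivative real (Suc n) * binom_prob n p c) (at p)"
proof -
  have telescope: "(\<Sum>i=c..n. binom_prob n p i - binom_prob n p (Suc i)) = binom_prob n p c"
  proof (cases "c \<le> n")
    case True
    then show ?thesis
      using sum_Suc_diff[of c n "\<lambda>i. - binom_prob n p i"] by (simp add: binom_prob_eq_0)
  qed (simp add: binom_prob_eq_0)
  have "((\<lambda>p. \<Sum>i=c..n. binom_prob (Suc n) p (Suc i)) has_real_derivative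
      (\<Sum>i=c..n. real (Suc n) * (binom_prob n p i - binom_prob n p (Suc i)))) (at p)"
    by (intro DERIV_sum has_real_derivative_binom_prob)
  then show ?thesis
    unfolding sum_distrib_left [symmetric] telescope binom_tail_def sum.shift_bounds_cl_Suc_ivl .
qed

lemma binom_tail_mono_prob:
  assumes "0 \<le> p" "p \<le> q" "q \<le> 1"
  shows "binom_tail n p c \<le> binom_tail n q c"
proof (cases c)
  case 0
  then show ?thesis
    using sum_lessThan_plus_binom_tail[of n p 0] sum_lessThan_plus_binom_tail[of n q 0] by simp
next
  case (Suc d)
  show ?thesis
  proof (cases n)
    case (Suc m)
    show ?thesis
      unfolding \<open>c = Suc d\<close> Suc
    proof (rule DERIV_nonneg_imp_nondecreasing[OF \<open>p \<le> q\<close>])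
      fix x assume "p \<le> x" "x \<le> q"
      then show "\<exists>y. ((\<lambda>p. binom_tail (Suc m) p (Suc d)) has_real_derivative y) (at x) \<and> 0 \<le> y"
        using has_real_derivative_binom_tail[of m d x] binom_prob_nonneg[of x m d] assms
        by (intro exI[of _ "real (Suc m) * binom_prob m x d"] conjI) auto
    qed
  qed (simp add: binom_tail_def Suc)
qed

section \<open>Tails of binomial distributions with the same mean\<close>

text \<open>
  Move continuously from \<open>n + 1\<close> trials to \<open>n + 2\<close> trials without changing the mean: take \<open>n + 1\<close> trials
  with success probability \<open>q\<close> and one further trial with success probability \<open>r = \<mu> - (n + 1) q\<close>. At
  \<open>q = \<mu> / (n + 1)\<close> the further trial never succeeds, and at \<open>q = \<mu> / (n + 2)\<close> all trials are alike. Let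
  \<open>F q\<close> be the probability of at least \<open>d + 2\<close> successes. Its derivative is \<open>(n + 1) (q - r)\<close> times the
  difference of the probabilities of \<open>d + 1\<close> and of \<open>d\<close> successes in \<open>n\<close> trials. Between the two ends
  \<open>r \<le> q\<close>, and the difference is not positive because \<open>(n + 1) q \<le> \<mu> \<le> d + 1\<close>. So \<open>F\<close> increases as \<open>q\<close>
  moves down to \<open>\<mu> / (n + 2)\<close>.
\<close>

lemma binom_tail_same_mean_Suc_le:
  assumes "0 \<le> \<mu>" "\<mu> \<le> real (Suc n)" "\<mu> \<le> real (Suc d)"
  shows "binom_tail (Suc n) (\<mu> / real (Suc n)) (Suc (Suc d))
       \<le> binom_tail (Suc (Suc n)) (\<mu> / real (Suc (Suc n))) (Suc (Suc d))"
proof -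
  define F where "F q = binom_tail (Suc n) q (Suc (Suc d))
      + (\<mu> - real (Suc n) * q) * binom_prob (Suc n) q (Suc d)" for q
  define F' where "F' q = real (Suc n) * (((real (Suc n) + 1) * q - \<mu>)
      * (binom_prob n q (Suc d) - binom_prob n q d))" for q
  have deriv: "(F has_real_derivative F' q) (at q)" for q
    unfolding F_def
    by (rule derivative_eq_intros has_real_derivative_binom_tail has_real_derivative_binom_prob refl)+
       (simp add: F'_def binom_prob_Suc_Suc algebra_simps)
  have "F (\<mu> / real (Suc n)) \<le> F (\<mu> / real (Suc (Suc n)))"
  proof (rule DERIV_nonpos_imp_nonincreasing[where f = F])
    show "\<mu> / real (Suc (Suc n)) \<le> \<mu> / real (Suc n)"
      using assms by (intro divide_left_mono) auto
    fix q assume q: "\<mu> / real (Suc (Suc n)) \<le> q" "q \<le> \<mu> / real (Suc n)"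
    have "0 \<le> \<mu> / real (Suc (Suc n))" "\<mu> / real (Suc n) \<le> 1"
      using assms by auto
    then have "0 \<le> q" "q \<le> 1"
      using q by linarith+
    have "\<mu> \<le> (real (Suc n) + 1) * q"
      using q(1) by (simp add: field_simps)
    moreover have "real (Suc n) * q \<le> real (Suc d)"
      using q(2) assms by (simp add: field_simps)
    ultimately have "F' q \<le> 0"
      unfolding F'_def using \<open>0 \<le> q\<close> \<open>q \<le> 1\<close> binom_prob_Suc_le[of q n d]
      by (intro mult_nonneg_nonpos) auto
    with deriv show "\<exists>y. (F has_real_derivative y) (at q) \<and> y \<le> 0"
      by blast
  qed
  moreover have "F (\<mu> / real (Suc n)) = binom_tail (Suc n) (\<mu> / real (Suc n)) (Suc (Suc d))"
    by (simp add: F_def)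
  moreover have "F (\<mu> / real (Suc (Suc n))) = binom_tail (Suc (Suc n)) (\<mu> / real (Suc (Suc n))) (Suc (Suc d))"
  proof -
    have "\<mu> - real (Suc n) * (\<mu> / real (Suc (Suc n))) = \<mu> / real (Suc (Suc n))"
      by (simp add: field_simps)
    then show ?thesis
      by (simp only: F_def binom_tail_Suc_Suc[of "Suc n"])
  qed
  ultimately show ?thesis
    by simp
qed

text \<open>
  Induction on \<open>n\<close> from \<open>n = c\<close>, where only the outcome with \<open>c\<close> successes is left in the tail.
\<close>

lemma power_le_binom_tail:
  assumes "0 \<le> \<mu>" "\<mu> + 1 \<le> real c" "2 \<le> c" "c \<le> n"
  shows "(\<mu> / real c) ^ c \<le> binom_tail n (\<mu> / real n) c"
  using \<open>c \<le> n\<close>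
proof (induction n rule: dec_induct)
  case base
  show ?case
    by (simp add: binom_tail_def binom_prob_def)
next
  case (step n)
  obtain d where d: "c = Suc (Suc d)"
    using \<open>2 \<le> c\<close> by (metis Suc_le_D numeral_2_eq_2 Suc_le_mono)
  obtain m where m: "n = Suc m"
    using step d by (cases n) auto
  have "binom_tail n (\<mu> / real n) c \<le> binom_tail (Suc n) (\<mu> / real (Suc n)) c"
    unfolding d m using assms step d m by (intro binom_tail_same_mean_Suc_le) auto
  with step show ?case by linarith
qed

text \<open>
  With \<open>a = 1 - x / n\<close>, the base on the right is \<open>a (1 + y)\<close> for \<open>y = x / ((n + 1) (n - x))\<close>, and
  Bernoulli's inequality gives \<open>(1 + y) ^ (n + 1) \<ge> 1 + x / (n - x) = 1 / a\<close>.
\<close>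

lemma one_minus_divide_power_Suc_mono:
  fixes x :: real
  assumes "0 \<le> x" "x < real n"
  shows "(1 - x / real n) ^ n \<le> (1 - x / real (Suc n)) ^ Suc n"
proof -
  define a where "a = 1 - x / real n"
  have "n > 0"
    using assms by (cases n) auto
  have a: "a > 0"
    using assms \<open>n > 0\<close> by (simp add: a_def field_simps)
  define y where "y = x / (real (Suc n) * (real n - x))"
  have y: "y \<ge> 0"
    using assms by (simp add: y_def)
  have "real (Suc n) * y = x / (real n - x)"
    by (simp add: y_def)
  then have "1 = a * (1 + real (Suc n) * y)"
    using assms \<open>n > 0\<close> by (simp add: a_def field_simps)
  also have "\<dots> \<le> a * (1 + y) ^ Suc n"
    using a y Bernoulli_inequality[of y "Suc n"] by (intro mult_left_mono) auto
  finally have "a ^ n * 1 \<le> a ^ n * (a * (1 + y) ^ Suc n)"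
    using a by (intro mult_left_mono) auto
  also have "\<dots> = (a * (1 + y)) ^ Suc n"
    by (simp add: power_mult_distrib mult_ac)
  also have "a * (1 + y) = 1 - x / real (Suc n)"
  proof -
    have "a = (real n - x) / real n"
      using \<open>n > 0\<close> by (simp add: a_def field_simps)
    moreover have "1 + y = real n * (real (Suc n) - x) / (real (Suc n) * (real n - x))"
    proof -
      define A where "A = real (Suc n) * (real n - x)"
      have "A \<noteq> 0"
        using assms by (simp add: A_def)
      moreover have "A + x = real n * (real (Suc n) - x)"
        by (simp add: A_def algebra_simps)
      ultimately show ?thesis
        unfolding y_def A_def [symmetric] by (simp add: add_divide_distrib [symmetric] divide_simps)
    qed
    moreover have "1 - x / real (Suc n) = (real (Suc n) - x) / real (Suc n)"
      by (simp add: field_simps)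
    moreover have "real n - x \<noteq> 0"
      using assms by simp
    ultimately show ?thesis
      using \<open>n > 0\<close> by (simp del: of_nat_Suc)
  qed
  finally show ?thesis
    by (simp add: a_def)
qed

lemma one_minus_divide_power_mono:
  fixes x :: real
  assumes "0 \<le> x" "x < real m" "m \<le> n"
  shows "(1 - x / real m) ^ m \<le> (1 - x / real n) ^ n"
  using \<open>m \<le> n\<close>
proof (induction n rule: dec_induct)
  case (step n)
  then show ?case
    using one_minus_divide_power_Suc_mono[of x n] assms by simp
qed simp

section \<open>The median of a binomial distribution with integer mean\<close>

text \<open>
  For \<open>m = n - k \<ge> k\<close>, the binomial distribution with mean \<open>k\<close> is skewed to the right, and this shows
  in the pairs of points that are symmetric about \<open>k - 1 / 2\<close>: the right point is at least as likely as
  the left one. For the innermost pair the ratio of right to left is \<open>(m + 1) / m\<close>. From one pair to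
  the next the ratio is multiplied by \<open>((m + 1)\<^sup>2 - a\<^sup>2) k\<^sup>2 / ((k\<^sup>2 - a\<^sup>2) m\<^sup>2)\<close> with \<open>a = j + 1\<close>, which is
  at least 1 since \<open>k \<le> m\<close>.
\<close>

lemma binom_prob_reflect_le:
  assumes "2 * k \<le> n" and "j < k"
  shows "binom_prob n (real k / real n) (k - Suc j) \<le> binom_prob n (real k / real n) (k + j)"
  using \<open>j < k\<close>
proof (induction j)
  let ?b = "binom_prob n (real k / real n)"
  define m where "m = real n - real k"
  have n: "0 < n" "0 < k" and km: "real k \<le> m" "0 < m" "real n = real k + m"
    using assms by (auto simp: m_def)
  have ratio: "real (Suc i) * m * ?b (Suc i) = (real n - real i) * real k * ?b i" for i
  proof -
    have "real (Suc i) * (real n * (1 - real k / real n)) * ?b (Suc i)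
        = real n * (real (Suc i) * (1 - real k / real n) * ?b (Suc i))"
      by (simp only: mult_ac)
    also have "\<dots> = real n * ((real n - real i) * (real k / real n) * ?b i)"
      by (simp only: binom_prob_Suc_times)
    also have "\<dots> = (real n - real i) * real k * ?b i"
      using n by simp
    also have "real n * (1 - real k / real n) = m"
      using n by (simp add: m_def field_simps)
    finally show ?thesis .
  qed
  {
    case 0
    obtain i where i: "k = Suc i" using n by (cases k) auto
    have "real k * (m * ?b k) = real k * ((m + 1) * ?b i)"
      using ratio[of i] km i by (simp add: algebra_simps)
    then have "m * ?b k = (m + 1) * ?b i"
      using n by simp
    then have "m * ?b i \<le> m * ?b k"
      using binom_prob_nonneg[of "real k / real n" n i] assms n by (simp add: algebra_simps)
    then show ?case
      using km i by simp
  next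
    case (Suc j)
    define a where "a = real j + 1"
    obtain i where i: "k = Suc (Suc j) + i"
      using Suc.prems by (metis Suc_leI le_Suc_ex)
    define A A' B B' where "A = ?b (Suc i)" and "A' = ?b i" and "B = ?b (k + j)" and "B' = ?b (Suc (k + j))"
    have a: "0 < a" "a < real k" "a \<le> m"
      using Suc.prems km by (auto simp: a_def)
    have "A \<le> B"
      using Suc.IH Suc.prems i by (simp add: A_def B_def)
    have "0 \<le> B"
      unfolding B_def by (intro binom_prob_nonneg) (use assms n in auto)
    have upper: "(real k + a) * m * B' = (m + 1 - a) * real k * B"
      using ratio[of "k + j"] km by (simp add: a_def B_def B'_def algebra_simps)
    have lower: "(real k - a) * m * A = (m + 1 + a) * real k * A'"
      using ratio[of i] km i by (simp add: a_def A_def A'_def algebra_simps)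
    \<comment> \<open>The factor by which the ratio of right to left changes is at least 1.\<close>
    have coeff: "((real k + a) * m) * ((real k - a) * m) \<le> ((m + 1 + a) * real k) * ((m + 1 - a) * real k)"
    proof -
      have "a\<^sup>2 * (real k)\<^sup>2 \<le> a\<^sup>2 * m\<^sup>2" "(real k)\<^sup>2 * m\<^sup>2 \<le> (real k)\<^sup>2 * (m + 1)\<^sup>2"
        using km a by (intro mult_left_mono power_mono; simp)+
      then show ?thesis
        by (simp add: power2_eq_square algebra_simps)
    qed
    have "((m + 1 + a) * real k) * ((real k + a) * m) * A' = ((real k + a) * m) * ((real k - a) * m) * A"
      using lower by (simp add: mult_ac)
    also have "\<dots> \<le> ((real k + a) * m) * ((real k - a) * m) * B"
      using \<open>A \<le> B\<close> a km by (intro mult_left_mono) auto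
    also have "\<dots> \<le> ((m + 1 + a) * real k) * ((m + 1 - a) * real k) * B"
      using coeff \<open>0 \<le> B\<close> by (intro mult_right_mono) auto
    also have "\<dots> = ((m + 1 + a) * real k) * ((real k + a) * m) * B'"
      using upper by (simp add: mult_ac)
    finally have "A' \<le> B'"
      using a km n by (subst (asm) mult_le_cancel_left_pos) (auto intro!: mult_pos_pos)
    then show ?case
      using i by (simp add: A'_def B'_def)
  }
qed

lemma binom_tail_mean_ge_half_if_le:
  assumes "2 * k \<le> n"
  shows "1 / 2 \<le> binom_tail n (real k / real n) k"
proof -
  let ?b = "binom_prob n (real k / real n)"
  have p: "0 \<le> real k / real n" "real k / real n \<le> 1"
    using assms by (auto simp: divide_le_eq_1)
  have "(\<Sum>i<k. ?b i) = (\<Sum>j<k. ?b (k - Suc j))"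
    by (rule sum.nat_diff_reindex [symmetric])
  also have "\<dots> \<le> (\<Sum>j<k. ?b (k + j))"
    using binom_prob_reflect_le[OF assms] by (intro sum_mono) auto
  also have "\<dots> = (\<Sum>i\<in>(+) k ` {..<k}. ?b i)"
    by (simp add: sum.reindex)
  also have "\<dots> \<le> binom_tail n (real k / real n) k"
    unfolding binom_tail_def using assms binom_prob_nonneg[OF p] by (intro sum_mono2) auto
  finally show ?thesis
    using sum_lessThan_plus_binom_tail[of n "real k / real n" k] by linarith
qed

text \<open>
  The function \<open>ln ((1 + x) / (1 - x)) / x\<close> increases on \<open>(0, 1)\<close>, and \<open>s / p \<le> s / q\<close>. As \<open>k\<close> and \<open>m\<close> are
  proportional to \<open>p\<close> and \<open>q\<close>, comparing its values at these two points is the claim. The proof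
  differentiates the logarithm \<open>h\<close> of the quotient of the two sides in \<open>s\<close>.
\<close>

lemma power_reflect_le:
  fixes p q s :: real
  assumes "0 \<le> s" "s < q" "q \<le> p" and ratio: "real k * q = real m * p"
  shows "(p + s) ^ k * (q - s) ^ m \<le> (p - s) ^ k * (q + s) ^ m"
proof -
  define h where "h s = real k * (ln (p - s) - ln (p + s)) + real m * (ln (q + s) - ln (q - s))" for s
  have "h 0 \<le> h s"
  proof (rule DERIV_nonneg_imp_nondecreasing[where f = h, OF \<open>0 \<le> s\<close>])
    fix t assume t: "0 \<le> t" "t \<le> s"
    have pos: "0 < p - t" "0 < p + t" "0 < q - t" "0 < q + t" "0 < p" "0 < q"
      using assms t by auto
    have "(h has_real_derivative
        real k * (- (1 / (p - t)) - 1 / (p + t)) + real m * (1 / (q + t) + 1 / (q - t))) (at t)"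
      unfolding h_def using pos by (auto intro!: derivative_eq_intros)
    moreover have "- (1 / (p - t)) - 1 / (p + t) = - (2 * p / (p\<^sup>2 - t\<^sup>2))"
      using pos by (simp add: power2_eq_square square_diff_square_factored divide_simps)
    moreover have "1 / (q + t) + 1 / (q - t) = 2 * q / (q\<^sup>2 - t\<^sup>2)"
      using pos by (simp add: power2_eq_square square_diff_square_factored divide_simps)
    moreover have "real k * (2 * p / (p\<^sup>2 - t\<^sup>2)) \<le> real m * (2 * q / (q\<^sup>2 - t\<^sup>2))"
    proof -
      have q2: "0 < q\<^sup>2 - t\<^sup>2" and p2: "0 < p\<^sup>2 - t\<^sup>2"
        using pos by (simp_all add: power2_eq_square square_diff_square_factored)
      have "t\<^sup>2 * q\<^sup>2 \<le> t\<^sup>2 * p\<^sup>2"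
        using assms pos by (intro mult_left_mono power_mono) auto
      then have "p\<^sup>2 * (q\<^sup>2 - t\<^sup>2) \<le> q\<^sup>2 * (p\<^sup>2 - t\<^sup>2)"
        by (simp add: algebra_simps)
      then have "p\<^sup>2 / (p\<^sup>2 - t\<^sup>2) \<le> q\<^sup>2 / (q\<^sup>2 - t\<^sup>2)"
        using p2 q2 by (simp add: divide_simps)
      then have "2 * real k / p * (p\<^sup>2 / (p\<^sup>2 - t\<^sup>2)) \<le> 2 * real k / p * (q\<^sup>2 / (q\<^sup>2 - t\<^sup>2))"
        using pos by (intro mult_left_mono) auto
      moreover have "2 * real k / p * (p\<^sup>2 / (p\<^sup>2 - t\<^sup>2)) = real k * (2 * p / (p\<^sup>2 - t\<^sup>2))"
        using pos by (simp add: power2_eq_square)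
      moreover have "2 * real k / p = 2 * real m / q"
        using ratio pos by (simp add: field_simps)
      then have "2 * real k / p * (q\<^sup>2 / (q\<^sup>2 - t\<^sup>2)) = real m * (2 * q / (q\<^sup>2 - t\<^sup>2))"
        using pos by (simp add: power2_eq_square)
      ultimately show ?thesis by simp
    qed
    ultimately show "\<exists>y. (h has_real_derivative y) (at t) \<and> 0 \<le> y"
      by (intro exI conjI) auto
  qed
  then have "real k * ln (p + s) + real m * ln (q - s) \<le> real k * ln (p - s) + real m * ln (q + s)"
    by (simp add: h_def algebra_simps)
  then have "ln ((p + s) ^ k * (q - s) ^ m) \<le> ln ((p - s) ^ k * (q + s) ^ m)"
    using assms by (simp add: ln_mult ln_realpow)
  then show ?thesis
    using assms by (subst (asm) ln_le_cancel_iff) auto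
qed

text \<open>
  For \<open>p = k / n \<ge> 1 / 2\<close> the pairing of points can fail far from the mean, and the comparison is made in the
  parameter instead. Let \<open>T x\<close> be the tail from \<open>k\<close> for success probability \<open>x\<close>, and \<open>q = 1 - p\<close>. The
  derivative of \<open>T\<close> is a multiple of \<open>x ^ (k - 1) (1 - x) ^ (n - k)\<close>, and by the lemma above it is at least as large
  at \<open>p - s\<close> as at \<open>p + s\<close> for \<open>0 \<le> s \<le> q\<close>. Integrating over \<open>s\<close> gives
  \<open>T p - T (p - q) \<ge> T 1 - T p\<close>, hence \<open>2 T p \<ge> T 1 = 1\<close>.
\<close>

lemma binom_tail_mean_ge_half_if_ge:
  assumes "n \<le> 2 * k" "k < n" "0 < k"
  shows "1 / 2 \<le> binom_tail n (real k / real n) k"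
proof -
  obtain N K where NK: "n = Suc N" "k = Suc K"
    using assms by (metis gr0_conv_Suc less_trans)
  define m where "m = N - K"
  define p q where "p = real k / real n" and "q = real m / real n"
  have m: "0 < m" "m \<le> k" "real n = real k + real m"
    using assms NK by (auto simp: m_def)
  have pq: "0 < q" "q \<le> p" "p + q = 1" "real k * q = real m * p"
    using m assms by (auto simp: p_def q_def divide_right_mono add_divide_distrib [symmetric])
  define T where "T x = binom_tail n x k" for x
  have T': "(T has_real_derivative real n * binom_prob N x K) (at x)" for x
    using has_real_derivative_binom_tail[of N K x] unfolding T_def NK .
  define D where "D s = 2 * T p - T (p - s) - T (p + s)" for s
  have "D 0 \<le> D q"
  proof (rule DERIV_nonneg_imp_nondecreasing[where f = D])
    show "0 \<le> q" using pq by simp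
    fix s assume s: "0 \<le> s" "s \<le> q"
    have "(D has_real_derivative real n * binom_prob N (p - s) K - real n * binom_prob N (p + s) K) (at s)"
      unfolding D_def
      by (rule derivative_eq_intros DERIV_chain2[OF T'] refl)+ simp
    moreover have "binom_prob N (p + s) K \<le> binom_prob N (p - s) K"
    proof -
      have "(p + s) ^ K * (q - s) ^ m \<le> (p - s) ^ K * (q + s) ^ m"
      proof (cases "s = q")
        case True
        then show ?thesis using m pq by (simp add: power_0_left)
      next
        case False
        \<comment> \<open>The reflection inequality has exponent \<open>k = K + 1\<close> where the derivative of \<open>T\<close> has \<open>K\<close>.
          The surplus factors satisfy \<open>p - s \<le> p + s\<close>, so they can be cancelled.\<close>
        have "(p + s) * ((p + s) ^ K * (q - s) ^ m) \<le> (p - s) * ((p - s) ^ K * (q + s) ^ m)"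
          using power_reflect_le[of s q p k m] False s pq NK by (simp add: mult_ac)
        also have "\<dots> \<le> (p + s) * ((p - s) ^ K * (q + s) ^ m)"
          using s pq by (intro mult_right_mono) auto
        finally show ?thesis
          using s pq by (subst (asm) mult_le_cancel_left_pos) auto
      qed
      then have "real (N choose K) * ((p + s) ^ K * (q - s) ^ m)
          \<le> real (N choose K) * ((p - s) ^ K * (q + s) ^ m)"
        by (intro mult_left_mono) auto
      moreover have complement: "1 - (p + s) = q - s" "1 - (p - s) = q + s"
        using pq by auto
      ultimately show ?thesis
        unfolding binom_prob_def complement m_def [symmetric] by (simp only: mult.assoc)
    qed
    then have "0 \<le> real n * binom_prob N (p - s) K - real n * binom_prob N (p + s) K"
      by (simp add: mult_left_mono)
    ultimately show "\<exists>y. (D has_real_derivative y) (at s) \<and> 0 \<le> y"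
      by blast
  qed
  moreover have "T (p - q) \<ge> 0"
    unfolding T_def using pq by (intro binom_tail_nonneg) auto
  moreover have "T (p + q) = 1"
  proof -
    have "(\<Sum>i<k. binom_prob n 1 i) = 0"
      using assms by (simp add: binom_prob_def power_0_left)
    then show ?thesis
      using sum_lessThan_plus_binom_tail[of n 1 k] pq by (simp add: T_def)
  qed
  ultimately show ?thesis
    by (simp add: D_def T_def p_def)
qed

lemma binom_tail_mean_ge_half:
  assumes "k \<le> n"
  shows "1 / 2 \<le> binom_tail n (real k / real n) k"
proof -
  consider "2 * k \<le> n" | "n \<le> 2 * k" "k < n" "0 < k" | "k = n" "0 < n"
    using assms by linarith
  then show ?thesis
  proof cases
    case 1
    then show ?thesis by (rule binom_tail_mean_ge_half_if_le)
  next
    case 2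
    then show ?thesis by (rule binom_tail_mean_ge_half_if_ge)
  next
    case 3
    then show ?thesis by (simp add: binom_tail_def binom_prob_def)
  qed
qed

section \<open>Stirling's formula and point probabilities\<close>

text \<open>
  Stirling's formula says that this quotient tends to \<open>sqrt (2 pi)\<close>. The upper bound on binomial
  coefficients needs only that it decreases and never falls below this limit.
\<close>

definition stirling_ratio :: "nat \<Rightarrow> real" where
  "stirling_ratio n = fact n * exp (real n) / (real n ^ n * sqrt (real n))"

lemma stirling_ratio_pos: "0 < n \<Longrightarrow> 0 < stirling_ratio n"
  by (simp add: stirling_ratio_def)

text \<open>
  The midpoint rule for the integral of \<open>1 / u\<close> from \<open>1\<close> to \<open>1 + x\<close> underestimates it by convexity.
\<close>

lemma ln_one_plus_ge:
  fixes x :: real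
  assumes "0 \<le> x"
  shows "2 * x / (2 + x) \<le> ln (1 + x)"
proof -
  have "ln (1 + 0) - 2 * 0 / (2 + 0) \<le> ln (1 + x) - 2 * x / (2 + x)"
  proof (rule DERIV_nonneg_imp_nondecreasing[OF assms])
    fix t :: real assume "0 \<le> t"
    have "((\<lambda>x. ln (1 + x) - 2 * x / (2 + x)) has_real_derivative 1 / (1 + t) - 4 / (2 + t)\<^sup>2) (at t)"
      using \<open>0 \<le> t\<close> by (auto intro!: derivative_eq_intros simp: field_simps power2_eq_square)
    moreover have "1 / (1 + t) - 4 / (2 + t)\<^sup>2 = t\<^sup>2 / ((1 + t) * (2 + t)\<^sup>2)"
      using \<open>0 \<le> t\<close> by (simp add: divide_simps) (simp add: power2_eq_square algebra_simps)
    ultimately show "\<exists>y. ((\<lambda>x. ln (1 + x) - 2 * x / (2 + x)) has_real_derivative y) (at t) \<and> 0 \<le> y"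
      using \<open>0 \<le> t\<close> by auto
  qed
  then show ?thesis by simp
qed

text \<open>
  The trapezoidal rule for the same integral overestimates it.
\<close>

lemma ln_one_plus_le:
  fixes x :: real
  assumes "0 \<le> x"
  shows "ln (1 + x) \<le> (1 + x - 1 / (1 + x)) / 2"
proof -
  have "(1 + 0 - 1 / (1 + 0)) / 2 - ln (1 + 0) \<le> (1 + x - 1 / (1 + x)) / 2 - ln (1 + x)"
  proof (rule DERIV_nonneg_imp_nondecreasing[OF assms])
    fix t :: real assume "0 \<le> t"
    have "((\<lambda>x. (1 + x - 1 / (1 + x)) / 2 - ln (1 + x)) has_real_derivative
        (1 + 1 / (1 + t)\<^sup>2) / 2 - 1 / (1 + t)) (at t)"
      using \<open>0 \<le> t\<close> by (auto intro!: derivative_eq_intros simp: power2_eq_square)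
    moreover have "(1 + 1 / (1 + t)\<^sup>2) / 2 - 1 / (1 + t) = (1 - 1 / (1 + t))\<^sup>2 / 2"
      by (simp add: power2_eq_square algebra_simps)
    ultimately show "\<exists>y. ((\<lambda>x. (1 + x - 1 / (1 + x)) / 2 - ln (1 + x)) has_real_derivative y) (at t) \<and> 0 \<le> y"
      by auto
  qed
  then show ?thesis by simp
qed

lemma ln_stirling_ratio:
  assumes "0 < n"
  shows "ln (stirling_ratio n) = ln (fact n) + real n - (real n + 1 / 2) * ln (real n)"
  using assms by (simp add: stirling_ratio_def ln_div ln_mult ln_realpow ln_sqrt algebra_simps)

lemma ln_stirling_ratio_diff:
  assumes "0 < n"
  shows "ln (stirling_ratio n) - ln (stirling_ratio (Suc n))
       = (real n + 1 / 2) * ln (1 + 1 / real n) - 1"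
proof -
  have "1 + 1 / real n = real (Suc n) / real n"
    using assms by (simp add: field_simps)
  then have quotient: "ln (1 + 1 / real n) = ln (real (Suc n)) - ln (real n)"
    using assms by (simp add: ln_div del: of_nat_Suc)
  have "ln (fact (Suc n) :: real) = ln (real (Suc n)) + ln (fact n)"
    by (simp add: ln_mult del: of_nat_Suc)
  moreover have "(real (Suc n) + 1 / 2) * ln (real (Suc n)) = (real n + 3 / 2) * ln (real (Suc n))"
    by simp
  ultimately show ?thesis
    unfolding ln_stirling_ratio[OF assms] ln_stirling_ratio[OF zero_less_Suc] quotient
    by (simp add: algebra_simps del: fact_Suc)
qed

lemma stirling_ratio_Suc_le:
  assumes "0 < n"
  shows "stirling_ratio (Suc n) \<le> stirling_ratio n"
proof -
  have "(real n + 1 / 2) * (2 * (1 / real n) / (2 + 1 / real n)) = 1"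
    using assms by (simp add: divide_simps)
  moreover have "(real n + 1 / 2) * (2 * (1 / real n) / (2 + 1 / real n)) \<le> (real n + 1 / 2) * ln (1 + 1 / real n)"
    by (intro mult_left_mono ln_one_plus_ge) auto
  ultimately have "ln (stirling_ratio (Suc n)) \<le> ln (stirling_ratio n)"
    using ln_stirling_ratio_diff[OF assms] by linarith
  then show ?thesis
    using assms by (simp add: stirling_ratio_pos)
qed

lemma stirling_ratio_antimono:
  assumes "0 < m" "m \<le> n"
  shows "stirling_ratio n \<le> stirling_ratio m"
  using \<open>m \<le> n\<close>
proof (induction n rule: dec_induct)
  case (step n)
  then show ?case
    using stirling_ratio_Suc_le[of n] assms by simp
qed simp

text \<open>
  The trapezoidal rule bounds each decrement of the logarithm by \<open>(1 / n - 1 / (n + 1)) / 4\<close>, so the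
  total decrease from the value \<open>1\<close> at \<open>n = 1\<close> is at most \<open>1 / 4\<close>. This keeps the limit positive.
\<close>

lemma ln_stirling_ratio_ge: "3 / 4 + 1 / (4 * real (Suc n)) \<le> ln (stirling_ratio (Suc n))"
proof (induction n)
  case 0
  show ?case by (simp add: stirling_ratio_def)
next
  case (Suc n)
  define x where "x = real (Suc n)"
  have x: "x > 0" by (simp add: x_def)
  have "(x + 1 / 2) * ln (1 + 1 / x) \<le> (x + 1 / 2) * ((1 + 1 / x - 1 / (1 + 1 / x)) / 2)"
    using x by (intro mult_left_mono ln_one_plus_le) auto
  also have "\<dots> = 1 + (1 / (4 * x) - 1 / (4 * (x + 1)))"
    using x by (simp add: divide_simps) (simp add: algebra_simps)
  finally have "ln (stirling_ratio (Suc n)) - ln (stirling_ratio (Suc (Suc n)))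
      \<le> 1 / (4 * x) - 1 / (4 * (x + 1))"
    using ln_stirling_ratio_diff[of "Suc n"] by (simp add: x_def)
  with Suc show ?case
    by (simp add: x_def)
qed

text \<open>
  Wallis' product in terms of the central binomial coefficient, as the square of
  \<open>4 ^ n / (2 n choose n)\<close> divided by \<open>2 n + 1\<close>.
\<close>

lemma wallis_product_eq:
  "(\<Prod>k=1..n. (4 * real k ^ 2) / (4 * real k ^ 2 - 1))
     = (2 ^ (2 * n) * fact n ^ 2 / fact (2 * n)) ^ 2 / real (2 * n + 1)"
proof (induction n)
  case (Suc n)
  define x where "x = real n"
  define Q :: real where "Q = 2 ^ (2 * n) * fact n ^ 2 / fact (2 * n)"
  have "x \<ge> 0" by (simp add: x_def)
  have Q: "(2 ^ (2 * Suc n) * fact (Suc n) ^ 2 / fact (2 * Suc n) :: real)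
      = Q * (2 * (x + 1) / (2 * x + 1))"
    by (simp add: Q_def x_def divide_simps) (simp add: power2_eq_square algebra_simps)
  have e: "4 * (x + 1)\<^sup>2 - 1 = (2 * x + 1) * (2 * x + 3)"
    by (simp add: power2_eq_square algebra_simps)
  have "(\<Prod>k=1..Suc n. (4 * real k ^ 2) / (4 * real k ^ 2 - 1))
      = (\<Prod>k=1..n. (4 * real k ^ 2) / (4 * real k ^ 2 - 1)) * (4 * (x + 1)\<^sup>2 / (4 * (x + 1)\<^sup>2 - 1))"
    by (simp add: x_def add.commute)
  also have "\<dots> = Q ^ 2 / (2 * x + 1) * (4 * (x + 1)\<^sup>2 / ((2 * x + 1) * (2 * x + 3)))"
    unfolding Suc.IH e by (simp add: Q_def x_def)
  also have "\<dots> = (Q * (2 * (x + 1) / (2 * x + 1))) ^ 2 / (2 * x + 3)"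
    using \<open>x \<ge> 0\<close> by (simp add: divide_simps power2_eq_square) (simp add: algebra_simps)
  finally show ?case
    unfolding Q by (simp add: x_def algebra_simps)
qed simp

text \<open>
  The powers and exponentials in the Stirling quotients of \<open>n\<close> and \<open>2 n\<close> cancel, and a
  factor that tends to \<open>1 / 4\<close> is left.
\<close>

lemma wallis_stirling_ratio:
  assumes "0 < n"
  shows "(2 ^ (2 * n) * fact n ^ 2 / fact (2 * n)) ^ 2 / real (2 * n + 1)
       = (stirling_ratio n ^ 2 / stirling_ratio (2 * n)) ^ 2 * (real n / (2 * real (2 * n + 1)))"
proof -
  define a b N where "a = stirling_ratio n" and "b = stirling_ratio (2 * n)" and "N = real n ^ n"
  define u v E T where "u = sqrt (real n)" and "v = sqrt (real (2 * n))" and "E = exp (real n)"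
    and "T = (2 ^ (2 * n) :: real)"
  have nz: "a \<noteq> 0" "b \<noteq> 0" "N \<noteq> 0" "u \<noteq> 0" "v \<noteq> 0" "E \<noteq> 0" "T \<noteq> 0"
    using assms stirling_ratio_pos[of n] stirling_ratio_pos[of "2 * n"]
    by (simp_all add: a_def b_def N_def u_def v_def E_def T_def)
  have 1: "fact n = a * (N * u) / E"
    using assms by (simp add: stirling_ratio_def a_def N_def u_def E_def)
  have "real (2 * n) ^ (2 * n) = T * N ^ 2"
    by (simp add: T_def N_def power_mult_distrib power_mult [symmetric] mult.commute)
  moreover have "exp (real (2 * n)) = E ^ 2"
    by (simp add: E_def exp_double)
  ultimately have 2: "fact (2 * n) = b * (T * N ^ 2 * v) / E ^ 2"
    using assms nz by (simp add: stirling_ratio_def b_def v_def del: of_nat_mult)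
  have "T * fact n ^ 2 / fact (2 * n) = a ^ 2 / b * (u ^ 2 / v)"
    unfolding 1 2 using nz by (simp add: divide_simps power2_eq_square)
  moreover have "(u ^ 2 / v) ^ 2 = real n / 2"
    using assms by (simp add: u_def v_def power_divide) (simp add: power2_eq_square)
  ultimately have "(T * fact n ^ 2 / fact (2 * n)) ^ 2 = (a ^ 2 / b) ^ 2 * (real n / 2)"
    by (simp only: power_mult_distrib)
  then have "(T * fact n ^ 2 / fact (2 * n)) ^ 2 / real (2 * n + 1)
      = (a ^ 2 / b) ^ 2 * (real n / 2) / real (2 * n + 1)"
    by (rule arg_cong)
  then show ?thesis
    unfolding a_def b_def T_def by (simp only: divide_divide_eq_left times_divide_eq_right)
qed

text \<open>
  The quotients decrease and are bounded away from zero, so they have a limit \<open>L > 0\<close>. The previous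
  lemma sends Wallis' product to \<open>(L\<^sup>2 / L)\<^sup>2 / 4 = L\<^sup>2 / 4\<close>, and its value is \<open>pi / 2\<close>.
\<close>

lemma LIMSEQ_stirling_ratio: "(\<lambda>n. stirling_ratio (Suc n)) \<longlonglongrightarrow> sqrt (2 * pi)"
proof -
  let ?a = "\<lambda>n. stirling_ratio (Suc n)"
  have lower: "exp (3 / 4) \<le> ?a n" for n
  proof -
    have "3 / 4 \<le> ln (?a n)"
      using ln_stirling_ratio_ge[of n] by (smt (verit) divide_nonneg_nonneg of_nat_0_le_iff)
    then show ?thesis
      using stirling_ratio_pos[of "Suc n"] by (subst ln_ge_iff [symmetric]) simp_all
  qed
  have "decseq ?a"
    by (intro decseq_SucI stirling_ratio_Suc_le) simp
  then obtain L where L: "?a \<longlonglongrightarrow> L"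
    using decseq_convergent[of ?a "exp (3 / 4)"] lower by blast
  have "exp (3 / 4) \<le> L"
    using L lower by (intro LIMSEQ_le_const) auto
  then have "L > 0"
    by (smt (verit) exp_gt_zero)
  have L2: "(\<lambda>n. stirling_ratio (2 * Suc n)) \<longlonglongrightarrow> L"
    using LIMSEQ_subseq_LIMSEQ[OF L, of "\<lambda>n. 2 * n + 1"]
    by (simp add: strict_mono_def o_def)
  have "(\<lambda>n. (?a n ^ 2 / stirling_ratio (2 * Suc n)) ^ 2 * (real (Suc n) / (2 * real (2 * Suc n + 1))))
      \<longlonglongrightarrow> (L ^ 2 / L) ^ 2 * (1 / 4)"
  proof -
    have lim: "(\<lambda>n. real (Suc n) / (2 * real (2 * Suc n + 1))) \<longlonglongrightarrow> 1 / 4"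
      by real_asymp
    show ?thesis
      using \<open>L > 0\<close>
      by (intro tendsto_mult[OF tendsto_power[OF tendsto_divide[OF tendsto_power[OF L] L2]] lim]) simp
  qed
  moreover have "(\<lambda>n. (?a n ^ 2 / stirling_ratio (2 * Suc n)) ^ 2 * (real (Suc n) / (2 * real (2 * Suc n + 1))))
      \<longlonglongrightarrow> pi / 2"
    using LIMSEQ_Suc[OF wallis]
    unfolding wallis_product_eq wallis_stirling_ratio[OF zero_less_Suc] .
  ultimately have "(L ^ 2 / L) ^ 2 * (1 / 4) = pi / 2"
    by (rule LIMSEQ_unique)
  then have "L ^ 2 = 2 * pi"
    using \<open>L > 0\<close> by (simp add: power2_eq_square)
  then have "L = sqrt (2 * pi)"
    using \<open>L > 0\<close> by (simp add: real_sqrt_unique)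
  with L show ?thesis by simp
qed

lemma stirling_ratio_ge:
  assumes "0 < n"
  shows "sqrt (2 * pi) \<le> stirling_ratio n"
proof -
  have "decseq (\<lambda>n. stirling_ratio (Suc n))"
    by (intro decseq_SucI stirling_ratio_Suc_le) simp
  from decseq_ge[OF this LIMSEQ_stirling_ratio, of "n - 1"] assms show ?thesis
    by simp
qed

text \<open>
  With Stirling quotients \<open>a\<close>, the coefficient is \<open>a (j + m) / (a j * a m)\<close> times the right-hand side
  without its factor \<open>1 / sqrt (2 pi)\<close>. Monotonicity gives \<open>a (j + m) \<le> a j\<close>, and \<open>a m\<close> is at least its limit.
\<close>

lemma binomial_le_entropy_bound:
  assumes "0 < j" "0 < m"
  shows "real ((j + m) choose j)
       \<le> sqrt (real (j + m) / (2 * pi * real j * real m)) * (real (j + m) ^ (j + m) / (real j ^ j * real m ^ m))"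
proof -
  define n where "n = j + m"
  have n: "0 < n" using assms by (simp add: n_def)
  have f: "fact n = stirling_ratio n * (real n ^ n * sqrt (real n)) / exp (real n)" if "0 < n" for n
    using that by (simp add: stirling_ratio_def)
  have "real (n choose j) = fact n / (fact j * fact m)"
    by (simp add: n_def binomial_fact)
  also have "\<dots> = stirling_ratio n / (stirling_ratio j * stirling_ratio m)
      * (sqrt (real n) / (sqrt (real j) * sqrt (real m)) * (real n ^ n / (real j ^ j * real m ^ m)))"
  proof -
    have alg: "a * (P * u) / (F * G) / (b * (Q * v) / F * (c * (R * w) / G))
        = a / (b * c) * (u / (v * w) * (P / (Q * R)))"
      if "F \<noteq> 0" "G \<noteq> 0" for a b c F G P Q R u v w :: real
      using that by (simp add: divide_simps)
    have "exp (real n) = exp (real j) * exp (real m)"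
      by (simp add: n_def exp_add)
    then show ?thesis
      unfolding f[OF n] f[OF assms(1)] f[OF assms(2)] by (simp only: alg exp_not_eq_zero not_False_eq_True)
  qed
  also have "\<dots> \<le> 1 / sqrt (2 * pi)
      * (sqrt (real n) / (sqrt (real j) * sqrt (real m)) * (real n ^ n / (real j ^ j * real m ^ m)))"
  proof (rule mult_right_mono)
    have "stirling_ratio n / (stirling_ratio j * stirling_ratio m)
        \<le> stirling_ratio j / (stirling_ratio j * stirling_ratio m)"
      using assms stirling_ratio_antimono[of j n] stirling_ratio_pos[of j] stirling_ratio_pos[of m]
      by (intro divide_right_mono) (auto simp: n_def)
    also have "\<dots> = 1 / stirling_ratio m"
      using stirling_ratio_pos[OF assms(1)] by simp
    also have "\<dots> \<le> 1 / sqrt (2 * pi)"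
      using stirling_ratio_ge[OF assms(2)] stirling_ratio_pos[OF assms(2)]
      by (intro divide_left_mono mult_pos_pos) auto
    finally show "stirling_ratio n / (stirling_ratio j * stirling_ratio m) \<le> 1 / sqrt (2 * pi)" .
  qed simp
  also have "\<dots> = sqrt (real n / (2 * pi * real j * real m)) * (real n ^ n / (real j ^ j * real m ^ m))"
    by (simp add: real_sqrt_divide real_sqrt_mult mult_ac)
  finally show ?thesis
    by (simp add: n_def)
qed

text \<open>
  In the bound on the binomial coefficient, \<open>n ^ n\<close> cancels against the denominators of the powers of
  \<open>k / n\<close> and \<open>1 - k / n\<close>. For \<open>j = k\<close> only the square root remains.
\<close>

lemma binom_prob_at_mean_le:
  assumes "k \<le> n" "0 < j" "j < n"
  shows "binom_prob n (real k / real n) j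
       \<le> sqrt (real n / (2 * pi * real j * (real n - real j)))
         * (real k / real j) ^ j * ((real n - real k) / (real n - real j)) ^ (n - j)"
proof -
  define m where "m = n - j"
  have m: "0 < m" "j + m = n" "real m = real n - real j" and n: "0 < n"
    using assms by (auto simp: m_def)
  define p where "p = real k / real n"
  have p: "0 \<le> p" "p \<le> 1" "1 - p = (real n - real k) / real n"
    using assms n by (auto simp: p_def field_simps)
  have powers: "real n ^ n / (real j ^ j * real m ^ m) * (p ^ j * (1 - p) ^ m)
      = (real k / real j) ^ j * ((real n - real k) / real m) ^ m"
  proof -
    have "real n ^ n = real n ^ j * real n ^ m"
      using m(2) by (metis power_add)
    then show ?thesis
      unfolding p(3) unfolding p_def using n by (simp add: power_divide)
  qed
  have "binom_prob n p j = real ((j + m) choose j) * (p ^ j * (1 - p) ^ m)"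
    using m by (simp add: binom_prob_def m_def)
  also have "\<dots> \<le> (sqrt (real (j + m) / (2 * pi * real j * real m))
      * (real (j + m) ^ (j + m) / (real j ^ j * real m ^ m))) * (p ^ j * (1 - p) ^ m)"
    using p m assms by (intro mult_right_mono binomial_le_entropy_bound) auto
  also have "\<dots> = sqrt (real n / (2 * pi * real j * real m))
      * ((real k / real j) ^ j * ((real n - real k) / real m) ^ m)"
    unfolding m(2) powers [symmetric] by (simp only: mult.assoc)
  finally show ?thesis
    by (simp add: p_def m(3) m_def [symmetric] mult.assoc)
qed

section \<open>Binomially distributed random variables\<close>

lemma binomially_distributed_measure_eq:
  assumes "binomially_distributed M X n p" "i \<le> n"
  shows "measure M {\<omega> \<in> space M. X \<omega> = real i} = binom_prob n p i"
  using assms by (simp add: binomially_distributed_def binom_prob_def)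

lemma (in prob_space) binomially_distributed_prob_image:
  assumes "binomially_distributed M X n p" "I \<subseteq> {..n}"
  shows "prob {\<omega> \<in> space M. X \<omega> \<in> real ` I} = (\<Sum>i\<in>I. binom_prob n p i)"
proof -
  have X [measurable]: "X \<in> borel_measurable M"
    using assms by (simp add: binomially_distributed_def)
  have "{\<omega> \<in> space M. X \<omega> \<in> real ` I} = (\<Union>i\<in>I. {\<omega> \<in> space M. X \<omega> = real i})"
    by auto
  also have "prob \<dots> = (\<Sum>i\<in>I. prob {\<omega> \<in> space M. X \<omega> = real i})"
  proof (rule finite_measure_finite_Union)
    show "finite I"
      using assms(2) by (rule finite_subset) simp
    show "(\<lambda>i. {\<omega> \<in> space M. X \<omega> = real i}) ` I \<subseteq> events"
      by auto
  qed (auto simp: disjoint_family_on_def)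
  also have "\<dots> = (\<Sum>i\<in>I. binom_prob n p i)"
    using assms by (intro sum.cong refl binomially_distributed_measure_eq) auto
  finally show ?thesis .
qed

text \<open>
  The point probabilities on \<open>{0..n}\<close> add up to 1, which leaves no mass for other values.
\<close>

lemma (in prob_space) binomially_distributed_AE:
  assumes "binomially_distributed M X n p"
  shows "AE \<omega> in M. X \<omega> \<in> real ` {..n}"
proof -
  have X [measurable]: "X \<in> borel_measurable M"
    using assms by (simp add: binomially_distributed_def)
  have "{\<omega> \<in> space M. X \<omega> \<in> real ` {..n}} = X -` (real ` {..n}) \<inter> space M"
    by auto
  also have "\<dots> \<in> events"
    by (intro measurable_sets[OF X] borel_closed finite_imp_closed) simp
  finally have "{\<omega> \<in> space M. X \<omega> \<in> real ` {..n}} \<in> events" .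
  moreover have "prob {\<omega> \<in> space M. X \<omega> \<in> real ` {..n}} = 1"
    using binomially_distributed_prob_image[OF assms order_refl] by (simp add: sum_binom_prob)
  ultimately show ?thesis
    using prob_Collect_eq_1[of "\<lambda>\<omega>. X \<omega> \<in> real ` {..n}"] by simp
qed

lemma (in prob_space) binomially_distributed_expectation:
  assumes "binomially_distributed M X n p"
  shows "expectation X = real n * p"
proof -
  have X [measurable]: "X \<in> borel_measurable M"
    using assms by (simp add: binomially_distributed_def)
  define A where "A i = {\<omega> \<in> space M. X \<omega> = real i}" for i
  have A [measurable]: "A i \<in> events" for i
    unfolding A_def by measurable
  have "expectation X = expectation (\<lambda>\<omega>. \<Sum>i\<le>n. real i * indicator (A i) \<omega>)"
  proof (rule integral_cong_AE)
    show "AE \<omega> in M. X \<omega> = (\<Sum>i\<le>n. real i * indicator (A i) \<omega>)"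
      using binomially_distributed_AE[OF assms] AE_space
    proof eventually_elim
      case (elim \<omega>)
      then obtain j where j: "j \<le> n" "X \<omega> = real j" by auto
      have "(\<Sum>i\<le>n. real i * indicator (A i) \<omega>) = (\<Sum>i\<le>n. if i = j then real j else 0)"
        using elim j by (intro sum.cong) (auto simp: A_def indicator_def)
      with j show ?case by simp
    qed
  qed measurable
  also have "\<dots> = (\<Sum>i\<le>n. real i * prob (A i))"
  proof -
    have "integrable M (indicator (A i) :: _ \<Rightarrow> real)" for i
      by (simp add: integrable_indicator_iff less_top [symmetric])
    then show ?thesis
      by (subst Bochner_Integration.integral_sum) simp_all
  qed
  also have "\<dots> = (\<Sum>i\<le>n. real i * binom_prob n p i)"
    using binomially_distributed_measure_eq[OF assms] by (simp add: A_def)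
  finally show ?thesis
    by (simp add: sum_times_binom_prob)
qed

lemma (in prob_space) binom_tail_le_prob_greater:
  assumes "binomially_distributed M X n p" and "x < real c"
  shows "binom_tail n p c \<le> prob {\<omega> \<in> space M. x < X \<omega>}"
proof -
  have X [measurable]: "X \<in> borel_measurable M"
    using assms by (simp add: binomially_distributed_def)
  have "binom_tail n p c = prob {\<omega> \<in> space M. X \<omega> \<in> real ` {c..n}}"
    using binomially_distributed_prob_image[OF assms(1), of "{c..n}"] by (auto simp: binom_tail_def)
  also have "\<dots> \<le> prob {\<omega> \<in> space M. x < X \<omega>}"
    using assms(2) by (intro finite_measure_mono) auto
  finally show ?thesis .
qed

section \<open>Exceeding the mean by more than one\<close>

theorem theorem12:
  fixes M :: "'a measure" and X :: "'a \<Rightarrow> real" and n k :: nat and p :: real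
  assumes "prob_space M"
    and "n \<ge> 3"
    and "1 / real n \<le> p" and "p < 1 - 1 / real n"
    and "binomially_distributed M X n p"
    and "int k = \<lfloor>real n * p\<rfloor>"
  shows
    "measure M {\<omega> \<in> space M. X \<omega> > prob_space.expectation M X + 1}
       \<ge> 0.5 - 2 * sqrt (real n / (2 * pi * real k * (real n - real k)))
     \<and> measure M {\<omega> \<in> space M. X \<omega> > prob_space.expectation M X + 1}
       \<ge> 0.25 - sqrt (real n / (2 * pi * (real k + 1) * (real n - real k - 1)))
            * (1 - 1 / (real k + 1)) ^ (k + 1)
            * (1 + 1 / (real n - real k - 1)) ^ (n - k - 1)
     \<and> measure M {\<omega> \<in> space M. X \<omega> > prob_space.expectation M X + 1} \<ge> 0.0370"
proof -
  interpret prob_space M by fact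
  have n: "0 < real n"
    using assms(2) by simp
  have p: "0 \<le> p" "p \<le> 1"
    using assms(3,4) divide_pos_pos[OF zero_less_one n] by linarith+
  have np: "real k \<le> real n * p" "real n * p < real k + 1"
    using assms(6) by linarith+
  have "1 \<le> real n * p" "real n * p < real n - 1"
    using assms(3,4) n by (simp_all add: field_simps)
  with np have "0 < real k" "real k < real n - 1"
    using assms(6) by linarith+
  then have k: "0 < k" "k + 2 \<le> n"
    by linarith+
  define p0 where "p0 = real k / real n"
  have p0: "0 \<le> p0" "p0 \<le> p" "p0 \<le> 1"
    using np n k by (auto simp: p0_def field_simps)
  define b where "b = binom_prob n p0"
  define t where "t = binom_tail n p0"
  define P where "P = prob {\<omega> \<in> space M. X \<omega> > expectation X + 1}"
  \<comment> \<open>Reduction to success probability \<open>k / n\<close>.\<close>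
  have "t (k + 2) \<le> binom_tail n p (k + 2)"
    unfolding t_def using p0 p by (intro binom_tail_mono_prob)
  also have "\<dots> \<le> P"
    unfolding P_def binomially_distributed_expectation[OF assms(5)]
    using np by (intro binom_tail_le_prob_greater[OF assms(5)]) simp
  finally have P: "t (k + 2) \<le> P" .
  have split: "t k = b k + t (k + 1)" "t (k + 1) = b (k + 1) + t (k + 2)"
    using binom_tail_eq_prob_plus_tail[of n p0 k] binom_tail_eq_prob_plus_tail[of n p0 "k + 1"]
    by (simp_all add: t_def b_def)

  have "P \<ge> 0.5 - 2 * sqrt (real n / (2 * pi * real k * (real n - real k)))"
  proof -
    have "1 / 2 \<le> t k"
      unfolding t_def p0_def using k by (intro binom_tail_mean_ge_half) simp
    moreover have "b (k + 1) \<le> b k"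
    proof -
      have "real (Suc n) * p0 = real k + p0"
        using n by (simp add: p0_def field_simps)
      then show ?thesis
        unfolding b_def using p0 binom_prob_Suc_le[of p0 n k] by simp
    qed
    moreover have "b k \<le> sqrt (real n / (2 * pi * real k * (real n - real k)))"
      unfolding b_def p0_def using binom_prob_at_mean_le[of k n k] k by simp
    ultimately show ?thesis
      using P split by simp
  qed
  moreover have "P \<ge> 0.25 - sqrt (real n / (2 * pi * (real k + 1) * (real n - real k - 1)))
            * (1 - 1 / (real k + 1)) ^ (k + 1)
            * (1 + 1 / (real n - real k - 1)) ^ (n - k - 1)"
  proof -
    \<comment> \<open>The value of \<open>(1 - 1 / (k + 1)) ^ (k + 1)\<close> at the smallest \<open>k\<close>, which is 1.\<close>
    have "1 / 4 = (1 - 1 / real 2) ^ 2"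
      by (simp add: power2_eq_square)
    also have "\<dots> \<le> (1 - 1 / real (k + 1)) ^ (k + 1)"
      using k by (intro one_minus_divide_power_mono) auto
    also have "1 - 1 / real (k + 1) = real k / real (k + 1)"
      by (simp add: field_simps)
    also have "(real k / real (k + 1)) ^ (k + 1) \<le> t (k + 1)"
      unfolding t_def p0_def using k by (intro power_le_binom_tail) auto
    finally have "1 / 4 \<le> t (k + 1)" .
    moreover have "b (k + 1) \<le> sqrt (real n / (2 * pi * (real k + 1) * (real n - real k - 1)))
            * (1 - 1 / (real k + 1)) ^ (k + 1)
            * (1 + 1 / (real n - real k - 1)) ^ (n - k - 1)"
    proof -
      have "1 - 1 / (real k + 1) = real k / (real k + 1)"
        by (simp add: field_simps)
      moreover have "1 + 1 / (real n - real k - 1) = (real n - real k) / (real n - real k - 1)"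
        using k by (simp add: field_simps)
      moreover have "real (k + 1) = real k + 1" "real n - (real k + 1) = real n - real k - 1"
          "n - (k + 1) = n - k - 1"
        by simp_all
      moreover have "k \<le> n" "0 < k + 1" "k + 1 < n"
        using k by simp_all
      ultimately show ?thesis
        using binom_prob_at_mean_le[of k n "k + 1"] by (simp only: b_def p0_def)
    qed
    ultimately show ?thesis
      using P split by simp
  qed
  moreover have "P \<ge> 0.0370"
  proof -
    \<comment> \<open>Again the value at \<open>k = 1\<close>. It is attained for \<open>n = 3\<close> and \<open>p = 1 / 3\<close>.\<close>
    have "1 / 27 = (1 - 2 / real 3) ^ 3"
      by (simp add: power3_eq_cube)
    also have "\<dots> \<le> (1 - 2 / real (k + 2)) ^ (k + 2)"
      using k by (intro one_minus_divide_power_mono) auto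
    also have "1 - 2 / real (k + 2) = real k / real (k + 2)"
      by (simp add: field_simps)
    also have "(real k / real (k + 2)) ^ (k + 2) \<le> t (k + 2)"
      unfolding t_def p0_def using k by (intro power_le_binom_tail) auto
    finally show ?thesis
      using P by simp
  qed
  ultimately show ?thesis
    unfolding P_def by blast
qed

end
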